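(* Let $\mathcal U\subseteq\mathcal T_n$ be an admissible tree set. For any two trees $T,T'\in\mathcal U$ and any rotation path $\gamma$ from $T$ to $T'$ whose intermediate trees all belong to $\mathcal U$, \[ \|B_T-B_{T'}\|\le\sum_{\rho\in\gamma}L_\rho\|\mathcal C_\rho\|. \] The coefficient diameter satisfies \[ \Delta_2^{\mathcal U}\le\sup_{T,T'\in\mathcal U}\inf_{\gamma}\sum_{\rho\in\gamma}L_\rho\|\mathcal C_\rho\|, \] where the infimum is taken over rotation paths from $T$ to $T'$ whose intermediate trees all belong to $\mathcal U$, with the convention that the infimum over an empty path set is $+\infty$.
   Context: $(\Omega,\mathcal F,\mu)$ is a measure space and $p$ a strictly positive probability density with respect to $\mu$. Generator: $f:(0,\infty)\to\mathbb R$ is convex and $C^3$ in a neighborhood of $1$, with $f(1)=f'(1)=0$, $f''(1)>0$; $A_2=f''(1)/2$, $A_3=f'''(1)/6$. Coefficient $\tau$: for $a,b>0$ and bounded measurable $u,v$ with $\Delta=v-u$, $J=\int\Delta^2p\,d\mu>0$, $L_3=\int\Delta^3p\,d\mu$, $t_0=\frac{\sqrt b}{\sqrt a+\sqrt b}$, \[ \tau(a,b;u,v)=\frac{A_3L_3\{at_0^3+b(1-t_0)^3\}}{2A_2J\{at_0+b(1-t_0)\}}. \] Trees: $\mathcal T_n$ ($n\ge2$ fixed) is the set of full ordered binary trees with $n$ leaves, labelled $1,\dots,n$ from left to right; the block of a node is the set of (consecutive) leaves below it, and an internal node merges the adjacent blocks $A$ (left child) and $B$ (right child) into $AB$. Leaf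 data: $\mathbf w=(w_1,\dots,w_n)\in(0,\infty)^n$, $G_i=\sqrt{w_i}$, and measurable $h_i,B_i$ with $\int h_i\,d\mu=\int B_i\,d\mu=0$ and $h_i/p,B_i/p$ bounded. Recursion: for a block, $G_A=\sum_{i\in A}G_i$. At leaves $H_i=h_i$ and the second-order coefficient is $B_i$. When a node merges $A$ and $B$, with $\theta_{AB}=\frac{G_B}{G_A+G_B}$, \[ H_{AB}=\frac{G_AH_A+G_BH_B}{G_A+G_B},\qquad B_{AB}=(1-\theta_{AB})B_A+\theta_{AB}B_B+\tau(G_A^2,G_B^2;H_A/p,H_B/p)(H_B-H_A). \] $B_T$ is the resulting coefficient at the root of $T$. Admissibility: a nonempty $\mathcal U\subseteq\mathcal T_n$ is an admissible tree set if, for all trees in $\mathcal U$, all coefficients $H_A,B_A$ generated by the recursion have $H_A/p,B_A/p\in L^\infty(\mu)$ and every generated merge is nondegenerate: $J(A,B)=\int_\Omega\left(\frac{H_B-H_A}{p}\right)^2p\,d\mu>0$. Norm and coefficient diameter: $\|\cdot\|$ is a norm on the local chart (on zero-mass functions $g$ with $g/p\in L^\infty(\mu)$), and $\Delta_2^{\mathcal U}=\sup_{T,T'\in\mathcal U}\|B_T-B_{T'}\|$. Rotations: an elementary rotation $\rho$ replaces a subtree of the form $(AB)C$ by $A(BC)$, or conversely, with $A,B,C$ adjacent blocks with fixed subtrees, leaving the rest of the tree unchanged; a rotation path is a finite sequence of trees in which consecutive trees differ by an elementary rotation. For such a rotation, $\mathcal C_\rho=\mathcal C(A,B,C)=B^{(AB)C}-B^{A(BC)}$,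 where $B^{(AB)C}$ and $B^{A(BC)}$ are the second-order coefficients produced by the recursion at block $ABC$ by the two bracketings. $L_\rho$ is the Lipschitz modulus, with respect to $\|\cdot\|$, of the surrounding averaging context, i.e. of the map sending the second-order coefficient at the rotated block $ABC$ to the second-order coefficient at the root under the recursion, the rest of the tree, all transformed masses, all first-order coefficients and all other leaf data being held fixed. *)

theory Defs
  imports "HOL-Analysis.Analysis"
begin

definition prob_density :: "'a measure \<Rightarrow> ('a \<Rightarrow> real) \<Rightarrow> bool" where
  "prob_density M p \<longleftrightarrow>
     integrable M p \<and> (\<forall>x\<in>space M. 0 < p x) \<and> (\<integral>x. p x \<partial>M) = 1"

definition C3_near :: "(real \<Rightarrow> real) \<Rightarrow> real \<Rightarrow> bool" where
  "C3_near f x \<longleftrightarrow>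
     (\<exists>S. open S \<and> x \<in> S \<and> S \<subseteq> {0<..} \<and>
        (\<forall>k<3. \<forall>y\<in>S. ((deriv ^^ k) f) differentiable (at y)) \<and>
        continuous_on S ((deriv ^^ 3) f))"

(* Only the values of f on the positive half-line are constrained or used. *)
definition generator :: "(real \<Rightarrow> real) \<Rightarrow> bool" where
  "generator f \<longleftrightarrow>
     convex_on {0<..} f \<and> C3_near f 1 \<and>
     f 1 = 0 \<and> deriv f 1 = 0 \<and> (deriv ^^ 2) f 1 > 0"

definition A2 :: "(real \<Rightarrow> real) \<Rightarrow> real" where
  "A2 f = (deriv ^^ 2) f 1 / 2"

definition A3 :: "(real \<Rightarrow> real) \<Rightarrow> real" where
  "A3 f = (deriv ^^ 3) f 1 / 6"

definition J_int :: "'a measure \<Rightarrow> ('a \<Rightarrow> real) \<Rightarrow> ('a \<Rightarrow> real) \<Rightarrow> ('a \<Rightarrow> real) \<Rightarrow> real" where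
  "J_int M p u v = (\<integral>x. (v x - u x)^2 * p x \<partial>M)"

definition L3_int :: "'a measure \<Rightarrow> ('a \<Rightarrow> real) \<Rightarrow> ('a \<Rightarrow> real) \<Rightarrow> ('a \<Rightarrow> real) \<Rightarrow> real" where
  "L3_int M p u v = (\<integral>x. (v x - u x)^3 * p x \<partial>M)"

definition tau ::
  "'a measure \<Rightarrow> ('a \<Rightarrow> real) \<Rightarrow> (real \<Rightarrow> real) \<Rightarrow>
   real \<Rightarrow> real \<Rightarrow> ('a \<Rightarrow> real) \<Rightarrow> ('a \<Rightarrow> real) \<Rightarrow> real" where
  "tau M p f a b u v =
     (let t0 = sqrt b / (sqrt a + sqrt b) in
      (A3 f * L3_int M p u v * (a * t0^3 + b * (1 - t0)^3)) /
      (2 * A2 f * J_int M p u v * (a * t0 + b * (1 - t0))))"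

(* Essentially bounded measurable functions, not quotiented by a.e. equality. *)
definition Linf :: "'a measure \<Rightarrow> ('a \<Rightarrow> real) set" where
  "Linf M = {g \<in> borel_measurable M. \<exists>K. AE x in M. \<bar>g x\<bar> \<le> K}"

(* Since p is integrable, every measurable g with g / p in Linf M is integrable, so the
   integral condition is never satisfied merely through the default value 0. *)
definition chart :: "'a measure \<Rightarrow> ('a \<Rightarrow> real) \<Rightarrow> ('a \<Rightarrow> real) set" where
  "chart M p =
     {g \<in> borel_measurable M. (\<lambda>x. g x / p x) \<in> Linf M \<and> (\<integral>x. g x \<partial>M) = 0}"

(* A norm on the a.e. classes of the chart, given on representatives: definiteness is up to
   a.e. equality, and invariance under a.e. equality follows from the triangle inequality. *)
definition chart_norm ::
  "'a measure \<Rightarrow> ('a \<Rightarrow> real) \<Rightarrow> (('a \<Rightarrow> real) \<Rightarrow> real) \<Rightarrow> bool" where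
  "chart_norm M p N \<longleftrightarrow>
     (\<forall>g\<in>chart M p. 0 \<le> N g \<and> (N g = 0 \<longleftrightarrow> (AE x in M. g x = 0))) \<and>
     (\<forall>g\<in>chart M p. \<forall>c. N (\<lambda>x. c * g x) = \<bar>c\<bar> * N g) \<and>
     (\<forall>g\<in>chart M p. \<forall>h\<in>chart M p. N (\<lambda>x. g x + h x) \<le> N g + N h)"

datatype ltree = Leaf nat | Node ltree ltree

primrec leaf_list :: "ltree \<Rightarrow> nat list" where
  "leaf_list (Leaf i) = [i]"
| "leaf_list (Node l r) = leaf_list l @ leaf_list r"

definition trees :: "nat \<Rightarrow> ltree set" where
  "trees n = {T. leaf_list T = [1..<Suc n]}"

definition block :: "ltree \<Rightarrow> nat set" where
  "block T = set (leaf_list T)"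

primrec subtrees :: "ltree \<Rightarrow> ltree set" where
  "subtrees (Leaf i) = {Leaf i}"
| "subtrees (Node l r) = insert (Node l r) (subtrees l \<union> subtrees r)"

definition leaf_data ::
  "'a measure \<Rightarrow> ('a \<Rightarrow> real) \<Rightarrow> nat \<Rightarrow>
   (nat \<Rightarrow> real) \<Rightarrow> (nat \<Rightarrow> 'a \<Rightarrow> real) \<Rightarrow> (nat \<Rightarrow> 'a \<Rightarrow> real) \<Rightarrow> bool" where
  "leaf_data M p n w h b \<longleftrightarrow>
     (\<forall>i\<in>{1..n}. 0 < w i \<and>
        h i \<in> borel_measurable M \<and> (\<integral>x. h i x \<partial>M) = 0 \<and>
        bounded ((\<lambda>x. h i x / p x) ` space M) \<and>
        b i \<in> borel_measurable M \<and> (\<integral>x. b i x \<partial>M) = 0 \<and>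
        bounded ((\<lambda>x. b i x / p x) ` space M))"

definition Gmass :: "(nat \<Rightarrow> real) \<Rightarrow> ltree \<Rightarrow> real" where
  "Gmass w T = (\<Sum>i\<in>block T. sqrt (w i))"

primrec Hcoef :: "(nat \<Rightarrow> real) \<Rightarrow> (nat \<Rightarrow> 'a \<Rightarrow> real) \<Rightarrow> ltree \<Rightarrow> 'a \<Rightarrow> real" where
  "Hcoef w h (Leaf i) = h i"
| "Hcoef w h (Node l r) =
     (\<lambda>x. (Gmass w l * Hcoef w h l x + Gmass w r * Hcoef w h r x) / (Gmass w l + Gmass w r))"

(* One merge step for the second-order coefficient: X and Y are the second-order coefficients
   of the two children, while masses and first-order coefficients are those of l and r. *)
definition merge_coef ::
  "'a measure \<Rightarrow> ('a \<Rightarrow> real) \<Rightarrow> (real \<Rightarrow> real) \<Rightarrow> (nat \<Rightarrow> real) \<Rightarrow> (nat \<Rightarrow> 'a \<Rightarrow> real) \<Rightarrow>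
   ltree \<Rightarrow> ltree \<Rightarrow> ('a \<Rightarrow> real) \<Rightarrow> ('a \<Rightarrow> real) \<Rightarrow> 'a \<Rightarrow> real" where
  "merge_coef M p f w h l r X Y =
     (let \<theta> = Gmass w r / (Gmass w l + Gmass w r);
          t = tau M p f ((Gmass w l)^2) ((Gmass w r)^2)
                (\<lambda>y. Hcoef w h l y / p y) (\<lambda>y. Hcoef w h r y / p y)
      in (\<lambda>x. (1 - \<theta>) * X x + \<theta> * Y x + t * (Hcoef w h r x - Hcoef w h l x)))"

primrec Bcoef ::
  "'a measure \<Rightarrow> ('a \<Rightarrow> real) \<Rightarrow> (real \<Rightarrow> real) \<Rightarrow>
   (nat \<Rightarrow> real) \<Rightarrow> (nat \<Rightarrow> 'a \<Rightarrow> real) \<Rightarrow> (nat \<Rightarrow> 'a \<Rightarrow> real) \<Rightarrow> ltree \<Rightarrow> 'a \<Rightarrow> real" where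
  "Bcoef M p f w h b (Leaf i) = b i"
| "Bcoef M p f w h b (Node l r) =
     merge_coef M p f w h l r (Bcoef M p f w h b l) (Bcoef M p f w h b r)"

definition admissible ::
  "'a measure \<Rightarrow> ('a \<Rightarrow> real) \<Rightarrow> (real \<Rightarrow> real) \<Rightarrow> nat \<Rightarrow>
   (nat \<Rightarrow> real) \<Rightarrow> (nat \<Rightarrow> 'a \<Rightarrow> real) \<Rightarrow> (nat \<Rightarrow> 'a \<Rightarrow> real) \<Rightarrow> ltree set \<Rightarrow> bool" where
  "admissible M p f n w h b U \<longleftrightarrow>
     U \<noteq> {} \<and> U \<subseteq> trees n \<and>
     (\<forall>T\<in>U. \<forall>S\<in>subtrees T.
        (\<lambda>x. Hcoef w h S x / p x) \<in> Linf M \<and> (\<lambda>x. Bcoef M p f w h b S x / p x) \<in> Linf M) \<and>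
     (\<forall>T\<in>U. \<forall>l r. Node l r \<in> subtrees T \<longrightarrow>
        (\<integral>x. ((Hcoef w h r x - Hcoef w h l x) / p x)^2 * p x \<partial>M) > 0)"

datatype ctx = Hole | InLeft ctx ltree | InRight ltree ctx

primrec plug :: "ctx \<Rightarrow> ltree \<Rightarrow> ltree" where
  "plug Hole S = S"
| "plug (InLeft c r) S = Node (plug c S) r"
| "plug (InRight l c) S = Node l (plug c S)"

(* The map from the second-order coefficient X of the block in the hole to the second-order
   coefficient at the root; S only supplies the mass and first-order coefficient of that block. *)
primrec ctx_map ::
  "'a measure \<Rightarrow> ('a \<Rightarrow> real) \<Rightarrow> (real \<Rightarrow> real) \<Rightarrow>
   (nat \<Rightarrow> real) \<Rightarrow> (nat \<Rightarrow> 'a \<Rightarrow> real) \<Rightarrow> (nat \<Rightarrow> 'a \<Rightarrow> real) \<Rightarrow>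
   ctx \<Rightarrow> ltree \<Rightarrow> ('a \<Rightarrow> real) \<Rightarrow> 'a \<Rightarrow> real" where
  "ctx_map M p f w h b Hole S X = X"
| "ctx_map M p f w h b (InLeft c r) S X =
     merge_coef M p f w h (plug c S) r (ctx_map M p f w h b c S X) (Bcoef M p f w h b r)"
| "ctx_map M p f w h b (InRight l c) S X =
     merge_coef M p f w h l (plug c S) (Bcoef M p f w h b l) (ctx_map M p f w h b c S X)"

(* RotR c A B C replaces (AB)C by A(BC) in the surrounding tree c; RotL is the converse. *)
datatype rotation = RotR ctx ltree ltree ltree | RotL ctx ltree ltree ltree

primrec rot_ctx :: "rotation \<Rightarrow> ctx" where
  "rot_ctx (RotR c A B C) = c"
| "rot_ctx (RotL c A B C) = c"

primrec rot_before :: "rotation \<Rightarrow> ltree" where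
  "rot_before (RotR c A B C) = Node (Node A B) C"
| "rot_before (RotL c A B C) = Node A (Node B C)"

primrec rot_after :: "rotation \<Rightarrow> ltree" where
  "rot_after (RotR c A B C) = Node A (Node B C)"
| "rot_after (RotL c A B C) = Node (Node A B) C"

definition rot_source :: "rotation \<Rightarrow> ltree" where
  "rot_source \<rho> = plug (rot_ctx \<rho>) (rot_before \<rho>)"

definition rot_target :: "rotation \<Rightarrow> ltree" where
  "rot_target \<rho> = plug (rot_ctx \<rho>) (rot_after \<rho>)"

(* rot_path U T \<gamma> T': applying the rotations in \<gamma> successively leads from T to T', and all
   trees visited, including T and T', belong to U. The list may be empty if T = T'. *)
primrec rot_path :: "ltree set \<Rightarrow> ltree \<Rightarrow> rotation list \<Rightarrow> ltree \<Rightarrow> bool" where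
  "rot_path U T [] T' \<longleftrightarrow> T \<in> U \<and> T = T'"
| "rot_path U T (\<rho> # \<gamma>) T' \<longleftrightarrow> T \<in> U \<and> rot_source \<rho> = T \<and> rot_path U (rot_target \<rho>) \<gamma> T'"

definition assoc_defect ::
  "'a measure \<Rightarrow> ('a \<Rightarrow> real) \<Rightarrow> (real \<Rightarrow> real) \<Rightarrow>
   (nat \<Rightarrow> real) \<Rightarrow> (nat \<Rightarrow> 'a \<Rightarrow> real) \<Rightarrow> (nat \<Rightarrow> 'a \<Rightarrow> real) \<Rightarrow>
   ltree \<Rightarrow> ltree \<Rightarrow> ltree \<Rightarrow> 'a \<Rightarrow> real" where
  "assoc_defect M p f w h b A B C =
     (\<lambda>x. Bcoef M p f w h b (Node (Node A B) C) x - Bcoef M p f w h b (Node A (Node B C)) x)"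

primrec rot_defect ::
  "'a measure \<Rightarrow> ('a \<Rightarrow> real) \<Rightarrow> (real \<Rightarrow> real) \<Rightarrow>
   (nat \<Rightarrow> real) \<Rightarrow> (nat \<Rightarrow> 'a \<Rightarrow> real) \<Rightarrow> (nat \<Rightarrow> 'a \<Rightarrow> real) \<Rightarrow> rotation \<Rightarrow> 'a \<Rightarrow> real" where
  "rot_defect M p f w h b (RotR c A B C) = assoc_defect M p f w h b A B C"
| "rot_defect M p f w h b (RotL c A B C) = assoc_defect M p f w h b A B C"

(* Least Lipschitz constant of F on D for the distance N (X - Y); infinite if there is none. *)
definition lip_modulus ::
  "('a \<Rightarrow> real) set \<Rightarrow> (('a \<Rightarrow> real) \<Rightarrow> real) \<Rightarrow> (('a \<Rightarrow> real) \<Rightarrow> 'a \<Rightarrow> real) \<Rightarrow> ereal" where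
  "lip_modulus D N F =
     Inf {ereal L | L. 0 \<le> L \<and>
       (\<forall>X\<in>D. \<forall>Y\<in>D. N (\<lambda>x. F X x - F Y x) \<le> L * N (\<lambda>x. X x - Y x))}"

(* The mass and first-order coefficient of the rotated block are the same for both bracketings,
   so using the bracketing before the rotation here is immaterial. *)
definition rot_lip ::
  "'a measure \<Rightarrow> ('a \<Rightarrow> real) \<Rightarrow> (real \<Rightarrow> real) \<Rightarrow>
   (nat \<Rightarrow> real) \<Rightarrow> (nat \<Rightarrow> 'a \<Rightarrow> real) \<Rightarrow> (nat \<Rightarrow> 'a \<Rightarrow> real) \<Rightarrow>
   (('a \<Rightarrow> real) \<Rightarrow> real) \<Rightarrow> rotation \<Rightarrow> ereal" where
  "rot_lip M p f w h b N \<rho> =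
     lip_modulus (chart M p) N (ctx_map M p f w h b (rot_ctx \<rho>) (rot_before \<rho>))"

definition path_cost ::
  "'a measure \<Rightarrow> ('a \<Rightarrow> real) \<Rightarrow> (real \<Rightarrow> real) \<Rightarrow>
   (nat \<Rightarrow> real) \<Rightarrow> (nat \<Rightarrow> 'a \<Rightarrow> real) \<Rightarrow> (nat \<Rightarrow> 'a \<Rightarrow> real) \<Rightarrow>
   (('a \<Rightarrow> real) \<Rightarrow> real) \<Rightarrow> rotation list \<Rightarrow> ereal" where
  "path_cost M p f w h b N \<gamma> =
     (\<Sum>\<rho>\<leftarrow>\<gamma>. rot_lip M p f w h b N \<rho> * ereal (N (rot_defect M p f w h b \<rho>)))"

definition coef_diameter ::
  "'a measure \<Rightarrow> ('a \<Rightarrow> real) \<Rightarrow> (real \<Rightarrow> real) \<Rightarrow>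
   (nat \<Rightarrow> real) \<Rightarrow> (nat \<Rightarrow> 'a \<Rightarrow> real) \<Rightarrow> (nat \<Rightarrow> 'a \<Rightarrow> real) \<Rightarrow>
   (('a \<Rightarrow> real) \<Rightarrow> real) \<Rightarrow> ltree set \<Rightarrow> ereal" where
  "coef_diameter M p f w h b N U =
     (SUP T\<in>U. SUP T'\<in>U.
        ereal (N (\<lambda>x. Bcoef M p f w h b T x - Bcoef M p f w h b T' x)))"

end

(* For a fixed tree context the root coefficient depends on the coefficient X of the rotated
   block through an affine map X |-> k X + const: the constant involves only masses and
   first-order coefficients, and those of the rotated block do not depend on its bracketing.
   Hence a rotation changes the root coefficient by k times the associativity defect, and the
   changes along a path are added up by the triangle inequality. *)

theory Submission
  imports Defs
begin

section \<open>The chart as a space closed under linear combinations\<close>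

text \<open>Almost everywhere \<open>\<bar>g x\<bar> \<le> K * p x\<close>, and \<open>p\<close> is
  integrable. Integrability makes the integral additive on the chart, so linear combinations keep
  zero mass.\<close>

lemma chart_integrable:
  assumes p: "prob_density M p" and g: "g \<in> chart M p"
  shows "integrable M g"
proof -
  from g obtain K where K: "AE x in M. \<bar>g x / p x\<bar> \<le> K"
    and gm: "g \<in> borel_measurable M"
    by (auto simp: chart_def Linf_def)
  have pos: "AE x in M. 0 < p x"
    using p by (auto simp: prob_density_def)
  show ?thesis
  proof (rule Bochner_Integration.integrable_bound)
    show "integrable M (\<lambda>x. K * p x)"
      using p by (simp add: prob_density_def)
    show "AE x in M. norm (g x) \<le> norm (K * p x)"
      using K pos
    proof eventually_elim
      case (elim x)
      then have "\<bar>g x\<bar> \<le> K * p x"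
        by (simp add: abs_divide pos_divide_le_eq)
      then show ?case
        by simp
    qed
  qed (rule gm)
qed

lemma Linf_lincomb:
  assumes "g \<in> Linf M" "h \<in> Linf M"
  shows "(\<lambda>x. s * g x + t * h x) \<in> Linf M"
proof -
  from assms obtain K L where K: "AE x in M. \<bar>g x\<bar> \<le> K" and L: "AE x in M. \<bar>h x\<bar> \<le> L"
    and [measurable]: "g \<in> borel_measurable M" "h \<in> borel_measurable M"
    by (auto simp: Linf_def)
  have "AE x in M. \<bar>s * g x + t * h x\<bar> \<le> \<bar>s\<bar> * K + \<bar>t\<bar> * L"
    using K L
  proof eventually_elim
    case (elim x)
    have "\<bar>s * g x + t * h x\<bar> \<le> \<bar>s\<bar> * \<bar>g x\<bar> + \<bar>t\<bar> * \<bar>h x\<bar>"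
      by (metis abs_mult abs_triangle_ineq)
    also have "\<dots> \<le> \<bar>s\<bar> * K + \<bar>t\<bar> * L"
      using elim by (intro add_mono mult_left_mono) auto
    finally show ?case .
  qed
  then show ?thesis
    by (auto simp: Linf_def)
qed

lemma chart_lincomb:
  assumes p: "prob_density M p" and g: "g \<in> chart M p" and h: "h \<in> chart M p"
  shows "(\<lambda>x. s * g x + t * h x) \<in> chart M p"
proof -
  have [measurable]: "g \<in> borel_measurable M" "h \<in> borel_measurable M"
    using g h by (auto simp: chart_def)
  have [simp]: "integrable M g" "integrable M h"
    using chart_integrable[OF p] g h by auto
  have "(\<lambda>x. s * (g x / p x) + t * (h x / p x)) \<in> Linf M"
    using g h by (intro Linf_lincomb) (auto simp: chart_def)
  then show ?thesis
    using g h by (simp add: chart_def add_divide_distrib)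
qed

lemma chart_diff:
  assumes "prob_density M p" "g \<in> chart M p" "h \<in> chart M p"
  shows "(\<lambda>x. g x - h x) \<in> chart M p"
  using chart_lincomb[OF assms, of 1 "-1"] by simp

lemma chart_bounded:
  assumes "prob_density M p" and [measurable]: "g \<in> borel_measurable M"
    and "(\<integral>x. g x \<partial>M) = 0" and "bounded ((\<lambda>x. g x / p x) ` space M)"
  shows "g \<in> chart M p"
proof -
  have [measurable]: "p \<in> borel_measurable M"
    using assms by (auto simp: prob_density_def)
  obtain K where "\<forall>x\<in>space M. \<bar>g x / p x\<bar> \<le> K"
    using assms(4) by (auto simp: bounded_iff)
  then have "AE x in M. \<bar>g x / p x\<bar> \<le> K"
    by auto
  then have "(\<lambda>x. g x / p x) \<in> Linf M"
    unfolding Linf_def by (auto intro!: exI[of _ K])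
  then show ?thesis
    using assms by (simp add: chart_def)
qed

section \<open>Coefficients generated by a tree lie in the chart\<close>

lemma Hcoef_in_chart:
  assumes p: "prob_density M p" and d: "leaf_data M p n w h b"
  shows "block S \<subseteq> {1..n} \<Longrightarrow> Hcoef w h S \<in> chart M p"
proof (induction S)
  case (Leaf i)
  then show ?case
    using d by (auto simp: leaf_data_def block_def intro!: chart_bounded[OF p])
next
  case (Node l r)
  then have "Hcoef w h l \<in> chart M p" "Hcoef w h r \<in> chart M p"
    by (auto simp: block_def)
  from chart_lincomb[OF p this, of "Gmass w l / (Gmass w l + Gmass w r)"
      "Gmass w r / (Gmass w l + Gmass w r)"]
  show ?case
    by (simp add: add_divide_distrib)
qed

text \<open>The value of \<open>tau\<close> is a single real number, so a merge is a linear
  combination of \<open>X\<close>, \<open>Y\<close> and the difference of the first-order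
  coefficients.\<close>

lemma merge_coef_in_chart:
  assumes p: "prob_density M p"
    and "Hcoef w h l \<in> chart M p" "Hcoef w h r \<in> chart M p" "X \<in> chart M p" "Y \<in> chart M p"
  shows "merge_coef M p f w h l r X Y \<in> chart M p"
proof -
  have comb: "(\<lambda>x. s * X x + s' * Y x + t * (Hcoef w h r x - Hcoef w h l x)) \<in> chart M p"
    for s s' t
    using chart_lincomb[OF p chart_lincomb[OF p assms(4,5)] chart_diff[OF p assms(3,2)],
        of 1 s s' t] by simp
  show ?thesis
    unfolding merge_coef_def Let_def by (rule comb)
qed

lemma Bcoef_in_chart:
  assumes p: "prob_density M p" and d: "leaf_data M p n w h b"
  shows "block S \<subseteq> {1..n} \<Longrightarrow> Bcoef M p f w h b S \<in> chart M p"
proof (induction S)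
  case (Leaf i)
  then show ?case
    using d by (auto simp: leaf_data_def block_def intro!: chart_bounded[OF p])
next
  case (Node l r)
  then show ?case
    by (auto simp: block_def intro!: merge_coef_in_chart[OF p] Hcoef_in_chart[OF p d])
qed

section \<open>Masses and first-order coefficients under change of bracketing\<close>

lemma leaf_list_plug_cong:
  "leaf_list S = leaf_list S' \<Longrightarrow> leaf_list (plug c S) = leaf_list (plug c S')"
  by (induction c) auto

lemma distinct_plugD: "distinct (leaf_list (plug c S)) \<Longrightarrow> distinct (leaf_list S)"
  by (induction c) auto

lemma block_plug: "block S \<subseteq> block (plug c S)"
  by (induction c) (auto simp: block_def)

text \<open>A block is a set, so a leaf occurring on both sides would be counted only once;
  distinctness makes the two child blocks disjoint.\<close>

lemma Gmass_Node:
  "distinct (leaf_list (Node l r)) \<Longrightarrow> Gmass w (Node l r) = Gmass w l + Gmass w r"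
  by (simp add: Gmass_def block_def sum.union_disjoint)

lemma Gmass_pos:
  assumes "\<And>i. i \<in> block S \<Longrightarrow> 0 < w i"
  shows "0 < Gmass w S"
proof -
  have "leaf_list S \<noteq> []"
    by (induction S) auto
  then show ?thesis
    unfolding Gmass_def using assms by (intro sum_pos) (auto simp: block_def)
qed

text \<open>Both sides are the average of the three first-order coefficients weighted by
  \<open>Gmass\<close>. The mass of the inner pair cancels, which needs it to be nonzero; positive
  weights ensure this.\<close>

lemma Hcoef_assoc:
  assumes dist: "distinct (leaf_list (Node (Node A B) C))"
    and w: "\<And>i. i \<in> block (Node (Node A B) C) \<Longrightarrow> 0 < w i"
  shows "Hcoef w h (Node (Node A B) C) = Hcoef w h (Node A (Node B C))"
proof
  fix x
  have pos: "0 < Gmass w A" "0 < Gmass w B" "0 < Gmass w C"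
    using w by (auto intro!: Gmass_pos simp: block_def)
  have G: "Gmass w (Node A B) = Gmass w A + Gmass w B"
    "Gmass w (Node B C) = Gmass w B + Gmass w C"
    using dist by (auto intro!: Gmass_Node)
  have "Gmass w A + Gmass w B \<noteq> 0" "Gmass w B + Gmass w C \<noteq> 0"
    using pos by linarith+
  then show "Hcoef w h (Node (Node A B) C) x = Hcoef w h (Node A (Node B C)) x"
    unfolding Hcoef.simps G by (simp add: add.assoc)
qed

lemma Hcoef_plug_cong:
  assumes "leaf_list S = leaf_list S'" "Hcoef w h S = Hcoef w h S'"
  shows "Hcoef w h (plug c S) = Hcoef w h (plug c S')"
  using assms by (induction c) (auto simp: Gmass_def block_def leaf_list_plug_cong[OF assms(1)])

text \<open>At every level the context sees \<open>S\<close> only through the mass and the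
  first-order coefficient of \<open>plug c S\<close>, and both depend only on the leaf list and
  \<open>Hcoef w h S\<close>.\<close>

lemma ctx_map_cong:
  assumes "leaf_list S = leaf_list S'" "Hcoef w h S = Hcoef w h S'"
  shows "ctx_map M p f w h b c S X = ctx_map M p f w h b c S' X"
proof -
  have "Gmass w (plug c S) = Gmass w (plug c S')" for c
    by (simp add: Gmass_def block_def leaf_list_plug_cong[OF assms(1)])
  then show ?thesis
    by (induction c) (simp_all add: merge_coef_def Hcoef_plug_cong[OF assms])
qed

lemma Bcoef_plug: "Bcoef M p f w h b (plug c S) = ctx_map M p f w h b c S (Bcoef M p f w h b S)"
  by (induction c) simp_all

text \<open>The factor \<open>k\<close> is the product of the averaging weights,
  \<open>1 - \<theta>\<close> at an \<open>InLeft\<close> and \<open>\<theta>\<close> at an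
  \<open>InRight\<close>, from the hole up to the root. The sibling and \<open>tau\<close> terms are
  the same for \<open>X\<close> and \<open>Y\<close> and cancel.\<close>

lemma ctx_map_affine:
  "\<exists>k. \<forall>X Y x. ctx_map M p f w h b c S X x - ctx_map M p f w h b c S Y x = k * (X x - Y x)"
proof (induction c)
  case Hole
  show ?case
    by (rule exI[of _ 1]) simp
next
  case (InLeft c r)
  then obtain k where k: "\<And>X Y x. ctx_map M p f w h b c S X x - ctx_map M p f w h b c S Y x
      = k * (X x - Y x)"
    by blast
  have "ctx_map M p f w h b (InLeft c r) S X x - ctx_map M p f w h b (InLeft c r) S Y x
      = (1 - Gmass w r / (Gmass w (plug c S) + Gmass w r)) * k * (X x - Y x)" for X Y x
    unfolding mult.assoc k[of X x Y, symmetric] by (simp add: merge_coef_def Let_def algebra_simps)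
  then show ?case
    by blast
next
  case (InRight l c)
  then obtain k where k: "\<And>X Y x. ctx_map M p f w h b c S X x - ctx_map M p f w h b c S Y x
      = k * (X x - Y x)"
    by blast
  have "ctx_map M p f w h b (InRight l c) S X x - ctx_map M p f w h b (InRight l c) S Y x
      = Gmass w (plug c S) / (Gmass w l + Gmass w (plug c S)) * k * (X x - Y x)" for X Y x
    unfolding mult.assoc k[of X x Y, symmetric] by (simp add: merge_coef_def Let_def right_diff_distrib)
  then show ?case
    by blast
qed

section \<open>Lipschitz modulus and norm\<close>

text \<open>The existence of some Lipschitz constant is needed: without one the modulus is
  \<open>\<infinity>\<close>, and the right-hand side is \<open>\<infinity> * 0 = 0\<close> when the distance vanishes.\<close>
lemma lip_modulus_bound:
  assumes "0 \<le> L" "\<And>X Y. X \<in> D \<Longrightarrow> Y \<in> D \<Longrightarrow> N (\<lambda>x. F X x - F Y x) \<le> L * N (\<lambda>x. X x - Y x)"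
    and X: "X \<in> D" and Y: "Y \<in> D" and nonneg: "0 \<le> N (\<lambda>x. X x - Y x)"
  shows "ereal (N (\<lambda>x. F X x - F Y x)) \<le> lip_modulus D N F * ereal (N (\<lambda>x. X x - Y x))"
proof (cases "N (\<lambda>x. X x - Y x) = 0")
  case True
  then show ?thesis
    using assms(2)[OF X Y] by (simp flip: zero_ereal_def)
next
  case False
  let ?d = "N (\<lambda>x. X x - Y x)" and ?e = "N (\<lambda>x. F X x - F Y x)"
  have d: "0 < ?d"
    using False nonneg by simp
  \<comment> \<open>The quotient is at most every Lipschitz constant, hence a lower bound of the set
    whose infimum is the modulus.\<close>
  have "ereal (?e / ?d) \<le> lip_modulus D N F"
    unfolding lip_modulus_def using X Y d by (auto intro!: Inf_greatest simp: pos_divide_le_eq)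
  then have "ereal (?e / ?d) * ereal ?d \<le> lip_modulus D N F * ereal ?d"
    using d by (intro ereal_mult_right_mono) auto
  then show ?thesis
    using d by simp
qed

lemma chart_norm_scale:
  "chart_norm M p N \<Longrightarrow> g \<in> chart M p \<Longrightarrow> N (\<lambda>x. c * g x) = \<bar>c\<bar> * N g"
  by (simp add: chart_norm_def)

lemma chart_norm_triangle:
  "chart_norm M p N \<Longrightarrow> g \<in> chart M p \<Longrightarrow> h \<in> chart M p \<Longrightarrow>
    N (\<lambda>x. g x + h x) \<le> N g + N h"
  by (simp add: chart_norm_def)

lemma chart_norm_minus_commute:
  assumes "prob_density M p" "chart_norm M p N" "X \<in> chart M p" "Y \<in> chart M p"
  shows "N (\<lambda>x. X x - Y x) = N (\<lambda>x. Y x - X x)"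
  using chart_norm_scale[OF assms(2) chart_diff[OF assms(1,4,3)], of "- 1"] by simp

section \<open>From one rotation to a path\<close>

text \<open>Source and target share one context map, applied to the coefficients of the two
  bracketings; their difference is the defect up to sign.\<close>

lemma rotation_bound:
  assumes p: "prob_density M p" and d: "leaf_data M p n w h b" and N: "chart_norm M p N"
    and T: "rot_source \<rho> \<in> trees n"
  shows "ereal (N (\<lambda>x. Bcoef M p f w h b (rot_source \<rho>) x - Bcoef M p f w h b (rot_target \<rho>) x))
    \<le> rot_lip M p f w h b N \<rho> * ereal (N (rot_defect M p f w h b \<rho>))"
proof -
  let ?S = "rot_before \<rho>" and ?S' = "rot_after \<rho>" and ?c = "rot_ctx \<rho>"
  let ?B = "Bcoef M p f w h b"
  have ll: "leaf_list ?S = leaf_list ?S'"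
    by (cases \<rho>) auto
  have bS: "block ?S \<subseteq> {1..n}"
    using block_plug[of ?S ?c] T by (auto simp: rot_source_def trees_def block_def)
  then have bS': "block ?S' \<subseteq> {1..n}"
    using ll by (simp add: block_def)
  have dist: "distinct (leaf_list ?S)"
    by (rule distinct_plugD[of ?c]) (use T in \<open>auto simp: rot_source_def trees_def\<close>)
  have w: "0 < w i" if "i \<in> block ?S" for i
    using bS that d by (auto simp: leaf_data_def)
  have "Hcoef w h ?S = Hcoef w h ?S'"
  proof (cases \<rho>)
    case (RotR c A B C)
    have "Hcoef w h (Node (Node A B) C) = Hcoef w h (Node A (Node B C))"
      using dist w by (intro Hcoef_assoc) (simp_all add: RotR)
    then show ?thesis
      unfolding RotR rot_before.simps rot_after.simps .
  next
    case (RotL c A B C)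
    have "Hcoef w h (Node (Node A B) C) = Hcoef w h (Node A (Node B C))"
      using dist w by (intro Hcoef_assoc) (simp_all add: RotL block_def)
    then show ?thesis
      unfolding RotL rot_before.simps rot_after.simps by (rule sym)
  qed
  \<comment> \<open>The context map is rebuilt over \<open>?S\<close> instead of \<open>?S'\<close>,
    so that it is literally the map occurring in \<open>rot_lip\<close>.\<close>
  then have target: "?B (rot_target \<rho>) = ctx_map M p f w h b ?c ?S (?B ?S')"
    unfolding rot_target_def Bcoef_plug by (rule ctx_map_cong[OF ll, symmetric])
  have X: "?B ?S \<in> chart M p" and Y: "?B ?S' \<in> chart M p"
    using Bcoef_in_chart[OF p d] bS bS' by auto
  \<comment> \<open>The defect is always left minus right bracketing, so for \<open>RotL\<close> it
    has the opposite sign to source minus target; the norm ignores this.\<close>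
  have "N (rot_defect M p f w h b \<rho>) = N (\<lambda>x. ?B ?S x - ?B ?S' x)"
    using chart_norm_minus_commute[OF p N X Y]
    by (cases \<rho>) (simp_all add: assoc_defect_def del: Bcoef.simps)
  moreover obtain k where k: "\<And>X Y x. ctx_map M p f w h b ?c ?S X x - ctx_map M p f w h b ?c ?S Y x
      = k * (X x - Y x)"
    using ctx_map_affine[of M p f w h b ?c ?S] by blast
  \<comment> \<open>Thus \<open>\<bar>k\<bar>\<close> is a Lipschitz constant on the chart, the
    witness that the modulus bound asks for.\<close>
  have "N (\<lambda>x. k * (X x - Y x)) = \<bar>k\<bar> * N (\<lambda>x. X x - Y x)"
    if "X \<in> chart M p" "Y \<in> chart M p" for X Y
    by (rule chart_norm_scale[OF N chart_diff[OF p that]])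
  then have "ereal (N (\<lambda>x. ctx_map M p f w h b ?c ?S (?B ?S) x - ctx_map M p f w h b ?c ?S (?B ?S') x))
    \<le> rot_lip M p f w h b N \<rho> * ereal (N (\<lambda>x. ?B ?S x - ?B ?S' x))"
    unfolding rot_lip_def using N chart_diff[OF p X Y]
    by (intro lip_modulus_bound[where L = "\<bar>k\<bar>"] X Y) (auto simp: k chart_norm_def)
  ultimately show ?thesis
    unfolding target by (simp add: rot_source_def Bcoef_plug)
qed

lemma rot_path_source: "rot_path U T \<gamma> T' \<Longrightarrow> T \<in> U"
  by (cases \<gamma>) auto

lemma rot_path_target: "rot_path U T \<gamma> T' \<Longrightarrow> T' \<in> U"
  by (induction \<gamma> arbitrary: T) auto

text \<open>Induction along the path: the tree after the first rotation is inserted by the triangle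
  inequality. All visited trees lie in \<open>U\<close>, so every coefficient involved is in the
  chart, where the norm axioms apply.\<close>

lemma path_bound:
  assumes p: "prob_density M p" and d: "leaf_data M p n w h b" and N: "chart_norm M p N"
    and U: "U \<subseteq> trees n"
    and path: "rot_path U T \<gamma> T'"
  shows "ereal (N (\<lambda>x. Bcoef M p f w h b T x - Bcoef M p f w h b T' x)) \<le> path_cost M p f w h b N \<gamma>"
proof -
  let ?B = "Bcoef M p f w h b"
  have B: "?B T \<in> chart M p" if "T \<in> U" for T
    using that U
    by (intro Bcoef_in_chart[OF p d]) (auto simp: trees_def block_def simp del: upt_Suc)
  show ?thesis
    using path
  proof (induction \<gamma> arbitrary: T)
    case Nil
    then have "?B T \<in> chart M p" "T' = T"
      using B by auto
    \<comment> \<open>The zero function is a chart element scaled by 0, hence has norm 0.\<close>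
    moreover from this have "N (\<lambda>x. ?B T x - ?B T x) = 0"
      using chart_norm_scale[OF N, of "?B T" 0] by simp
    ultimately show ?case
      by (simp add: path_cost_def)
  next
    case (Cons \<rho> \<gamma>)
    let ?S = "rot_target \<rho>"
    have path: "T \<in> U" "T = rot_source \<rho>" "rot_path U ?S \<gamma> T'"
      using Cons.prems by auto
    have chart: "?B T \<in> chart M p" "?B ?S \<in> chart M p" "?B T' \<in> chart M p"
      using B path rot_path_source rot_path_target by blast+
    have "N (\<lambda>x. (?B T x - ?B ?S x) + (?B ?S x - ?B T' x))
        \<le> N (\<lambda>x. ?B T x - ?B ?S x) + N (\<lambda>x. ?B ?S x - ?B T' x)"
      by (intro chart_norm_triangle[OF N] chart_diff[OF p] chart)
    then have "ereal (N (\<lambda>x. ?B T x - ?B T' x))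
        \<le> ereal (N (\<lambda>x. ?B T x - ?B ?S x)) + ereal (N (\<lambda>x. ?B ?S x - ?B T' x))"
      by simp
    also have "\<dots> \<le> rot_lip M p f w h b N \<rho> * ereal (N (rot_defect M p f w h b \<rho>))
        + path_cost M p f w h b N \<gamma>"
      using path U rotation_bound[OF p d N] Cons.IH by (intro add_mono) auto
    finally show ?case
      by (simp add: path_cost_def)
  qed
qed

theorem theorem12:
  fixes M :: "'a measure" and p :: "'a \<Rightarrow> real" and f :: "real \<Rightarrow> real"
    and n :: nat and w :: "nat \<Rightarrow> real" and h b :: "nat \<Rightarrow> 'a \<Rightarrow> real"
    and N :: "('a \<Rightarrow> real) \<Rightarrow> real" and U :: "ltree set"
  assumes "prob_density M p"
    and "generator f"
    and "2 \<le> n"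
    and "leaf_data M p n w h b"
    and "chart_norm M p N"
    and "admissible M p f n w h b U"
  shows "(\<forall>T\<in>U. \<forall>T'\<in>U. \<forall>\<gamma>. rot_path U T \<gamma> T' \<longrightarrow>
            ereal (N (\<lambda>x. Bcoef M p f w h b T x - Bcoef M p f w h b T' x))
              \<le> path_cost M p f w h b N \<gamma>) \<and>
         coef_diameter M p f w h b N U
           \<le> (SUP T\<in>U. SUP T'\<in>U. INF \<gamma>\<in>{\<gamma>. rot_path U T \<gamma> T'}. path_cost M p f w h b N \<gamma>)"
proof -
  have "U \<subseteq> trees n"
    using assms(6) by (simp add: admissible_def)
  note bound = path_bound[OF assms(1,4,5) this]
  \<comment> \<open>The suprema are compared pair by pair. The distance is a lower bound of all path
    costs, hence below their infimum; if no path exists, that infimum is \<open>\<infinity>\<close>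
    in \<open>ereal\<close>.\<close>
  have "coef_diameter M p f w h b N U
      \<le> (SUP T\<in>U. SUP T'\<in>U. INF \<gamma>\<in>{\<gamma>. rot_path U T \<gamma> T'}. path_cost M p f w h b N \<gamma>)"
    unfolding coef_diameter_def by (intro SUP_subset_mono INF_greatest order_refl) (simp add: bound)
  then show ?thesis
    using bound by blast
qed

end
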